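(* Let $p$ be a prime and let $(R,\mathfrak{m})$ be a finite local ring with characteristic $p$, and assume that $|R/\mathfrak{m}|=p^m$. Then there exist an element $\beta\in R$ and a subring $A=\mathbb{Z}_p[\beta]$ of $R$ such that $\beta^{p^{mt}-1}=1$ for some positive integer $t$ and $R/\mathfrak{m}=\overline{A}$. In this case, $A$ is a coefficient field of $R$.
   Context: All rings are commutative with identity. $\mathbb{Z}_p=\mathbb{Z}/p\mathbb{Z}$, regarded as the prime subring of $R$, and $\mathbb{Z}_p[\beta]$ is the subring of $R$ generated by $\mathbb{Z}_p$ and $\beta$. $\overline{A}$ denotes the image of $A$ under the natural map $R\to R/\mathfrak{m}$. A coefficient field of a local ring $(R,\mathfrak{m})$ is a subring of $R$ that is a field and that is mapped isomorphically onto $R/\mathfrak{m}$ by the natural map $R\to R/\mathfrak{m}$. *)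

theory Defs
  imports "HOL-Algebra.Algebra"
begin

locale local_cring = cring R + maximalideal M R for R (structure) and M +
  assumes maximal_unique: "maximalideal I R \<Longrightarrow> I = M"

definition ring_char :: "('a, 'b) ring_scheme \<Rightarrow> nat" where
  "ring_char R =
     (if \<exists>n::nat. 0 < n \<and> [n] \<cdot>\<^bsub>R\<^esub> \<one>\<^bsub>R\<^esub> = \<zero>\<^bsub>R\<^esub>
      then LEAST n::nat. 0 < n \<and> [n] \<cdot>\<^bsub>R\<^esub> \<one>\<^bsub>R\<^esub> = \<zero>\<^bsub>R\<^esub>
      else 0)"

(* The image of the canonical map from the integers; a copy of Z/pZ when ring_char R = p. *)
definition prime_subring :: "('a, 'b) ring_scheme \<Rightarrow> 'a set" where
  "prime_subring R = range (\<lambda>k::int. [k] \<cdot>\<^bsub>R\<^esub> \<one>\<^bsub>R\<^esub>)"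

definition prime_adjoin :: "('a, 'b) ring_scheme \<Rightarrow> 'a \<Rightarrow> 'a set" where
  "prime_adjoin R \<beta> = generate_ring R (prime_subring R \<union> {\<beta>})"

definition residue_map :: "('a, 'b) ring_scheme \<Rightarrow> 'a set \<Rightarrow> 'a \<Rightarrow> 'a set" where
  "residue_map R M x = M +>\<^bsub>R\<^esub> x"

definition coefficient_field :: "('a, 'b) ring_scheme \<Rightarrow> 'a set \<Rightarrow> 'a set \<Rightarrow> bool" where
  "coefficient_field R M A \<longleftrightarrow>
     subfield A R \<and> residue_map R M \<in> ring_iso (R\<lparr>carrier := A\<rparr>) (R Quot M)"

end

theory Submission
  imports Defs
begin

text \<open>
  Write \<open>Q = R/M\<close>. Everything rests on the maps \<open>x \<mapsto> x^q\<close> with \<open>q = p^(m*t)\<close>, which are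
  ring endomorphisms of \<open>R\<close> because \<open>R\<close> has characteristic \<open>p\<close>, and which
  induce the identity on the field \<open>Q\<close> of \<open>p^m\<close> elements.

  Existence: lift a generator of the cyclic group of units of \<open>Q\<close> to some \<open>b\<close> in \<open>R\<close>. All
  iterates \<open>b^(p^(m*i))\<close> lift the same generator, and since \<open>R\<close> is finite two of them
  coincide, say those for \<open>i\<close> and \<open>i + t\<close>. So \<open>\<beta> = b^(p^(m*i))\<close> satisfies
  \<open>\<beta>^(p^(m*t)) = \<beta>\<close>. It is a unit, being nonzero modulo \<open>M\<close>, and cancelling it gives the root
  of unity. Its powers, together with zero, already cover \<open>Q\<close>
  (\<open>exists_root_of_unity_lifting_generator\<close>).

  Coefficient field: for any such \<open>\<beta>\<close> and \<open>t\<close>, the fixed points of \<open>x \<mapsto> x^q\<close> form a subring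
  (\<open>frobenius_fixed_subring\<close>) that contains \<open>\<beta>\<close>, hence all of \<open>A\<close>. An element \<open>x\<close> of \<open>M\<close>
  with \<open>x^q = x\<close> is zero, since \<open>x * (1 - x^(q-1)) = 0\<close> and \<open>1 - x^(q-1)\<close> is a unit
  (\<open>member_pow_eq_self_imp_zero\<close>). Hence \<open>A\<close> meets \<open>M\<close> only in zero, and the residue map, which
  sends \<open>A\<close> onto \<open>Q\<close> by assumption, is an isomorphism from \<open>A\<close> to the field \<open>Q\<close>.
\<close>

section \<open>Frobenius powers in characteristic p\<close>

text \<open>
  Multiplying the expansion of \<open>(x + y)^n\<close> by \<open>x\<close> and by \<open>y\<close> gives two sums; shifting the index
  of the second by one aligns the monomials, and Pascal's rule adds the coefficients.
\<close>
lemma (in cring) binomial_theorem: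
  assumes [simp]: "x \<in> carrier R" "y \<in> carrier R"
  shows "(x \<oplus> y) [^] n =
    (\<Oplus>k\<in>{..n}. [(n choose k)] \<cdot> (x [^] k \<otimes> y [^] (n - k)))"
proof (induction n)
  case 0
  show ?case by simp
next
  case (Suc n)
  have times_x: "[(n choose k)] \<cdot> (x [^] k \<otimes> y [^] (n - k)) \<otimes> x
      = [(n choose k)] \<cdot> (x [^] Suc k \<otimes> y [^] (n - k))" for k
    by (simp add: add_pow_ldistr add_pow_rdistr m_ac)
  have times_y: "[(n choose k)] \<cdot> (x [^] k \<otimes> y [^] (n - k)) \<otimes> y
      = [(n choose k)] \<cdot> (x [^] k \<otimes> y [^] (Suc n - k))" if "k \<le> n" for k
    using that by (simp add: add_pow_ldistr add_pow_rdistr m_ac Suc_diff_le)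
  have "(x \<oplus> y) [^] Suc n
      = (\<Oplus>k\<in>{..n}. [(n choose k)] \<cdot> (x [^] k \<otimes> y [^] (n - k))) \<otimes> x
        \<oplus> (\<Oplus>k\<in>{..n}. [(n choose k)] \<cdot> (x [^] k \<otimes> y [^] (n - k))) \<otimes> y"
    using Suc.IH by (simp add: r_distr)
  also have "(\<Oplus>k\<in>{..n}. [(n choose k)] \<cdot> (x [^] k \<otimes> y [^] (n - k))) \<otimes> x
      = (\<Oplus>k\<in>{..n}. [(n choose k)] \<cdot> (x [^] Suc k \<otimes> y [^] (n - k)))"
    unfolding times_x[symmetric] by (rule finsum_ldistr) (auto simp: Pi_def)
  also have "(\<Oplus>k\<in>{..n}. [(n choose k)] \<cdot> (x [^] k \<otimes> y [^] (n - k))) \<otimes> y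
      = (\<Oplus>k\<in>{..n}. [(n choose k)] \<cdot> (x [^] k \<otimes> y [^] (n - k)) \<otimes> y)"
    by (rule finsum_ldistr) (auto simp: Pi_def)
  also have "\<dots> = (\<Oplus>k\<in>{..n}. [(n choose k)] \<cdot> (x [^] k \<otimes> y [^] (Suc n - k)))"
    by (rule finsum_cong') (auto simp: times_y Pi_def)
  \<comment> \<open>The extra summand vanishes, as \<open>n choose Suc n = 0\<close>; splitting off the summand for
      \<open>k = 0\<close> instead then realizes the shift.\<close>
  also have "\<dots> = (\<Oplus>k\<in>{..Suc n}. [(n choose k)] \<cdot> (x [^] k \<otimes> y [^] (Suc n - k)))"
    by (subst finsum_Suc) (auto simp: Pi_def binomial_eq_0)
  also have "\<dots> = (\<Oplus>k\<in>{..n}. [(n choose Suc k)] \<cdot> (x [^] Suc k \<otimes> y [^] (n - k)))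
      \<oplus> y [^] Suc n"
    by (subst finsum_Suc2) (auto simp: Pi_def)
  finally have "(x \<oplus> y) [^] Suc n
      = (\<Oplus>k\<in>{..n}. [(n choose k)] \<cdot> (x [^] Suc k \<otimes> y [^] (n - k))
          \<oplus> [(n choose Suc k)] \<cdot> (x [^] Suc k \<otimes> y [^] (n - k))) \<oplus> y [^] Suc n"
    by (subst finsum_addf) (auto simp: Pi_def a_assoc)
  also have "\<dots> = (\<Oplus>k\<in>{..n}. [(Suc n choose Suc k)] \<cdot> (x [^] Suc k \<otimes> y [^] (n - k)))
      \<oplus> y [^] Suc n"
    by (simp add: add.nat_pow_mult del: nat_pow_Suc)
  also have "\<dots> = (\<Oplus>k\<in>{..Suc n}. [(Suc n choose k)] \<cdot> (x [^] k \<otimes> y [^] (Suc n - k)))"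
    by (subst finsum_Suc2) (auto simp: Pi_def)
  finally show ?case .
qed

lemma ring_char_add_pow_one:
  assumes "ring_char R = n" "0 < n"
  shows "[n] \<cdot>\<^bsub>R\<^esub> \<one>\<^bsub>R\<^esub> = \<zero>\<^bsub>R\<^esub>"
  using assms LeastI_ex[of "\<lambda>n::nat. 0 < n \<and> [n] \<cdot>\<^bsub>R\<^esub> \<one>\<^bsub>R\<^esub> = \<zero>\<^bsub>R\<^esub>"]
  by (auto simp: ring_char_def split: if_splits)

lemma (in cring) add_pow_eq_zero_of_dvd:
  fixes n k :: nat
  assumes "[n] \<cdot> \<one> = \<zero>" "n dvd k" "x \<in> carrier R"
  shows "[k] \<cdot> x = \<zero>"
proof -
  from assms(2) obtain j where k: "k = n * j" ..
  have "[n] \<cdot> x = \<zero>"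
    using add_pow_ldistr[of \<one> x n] assms by simp
  then show ?thesis
    using add.nat_pow_pow[of x j n] assms(3) k by simp
qed

text \<open>
  A prime \<open>p\<close> divides every binomial coefficient \<open>p choose k\<close> with \<open>0 < k < p\<close>, so only the two
  extreme summands of the binomial expansion survive.
\<close>
lemma (in cring) freshmans_dream:
  fixes p :: nat
  assumes p: "Factorial_Ring.prime p" and char: "[p] \<cdot> \<one> = \<zero>"
    and [simp]: "x \<in> carrier R" "y \<in> carrier R"
  shows "(x \<oplus> y) [^] p = x [^] p \<oplus> y [^] p"
proof -
  have "p > 0" using p by (simp add: prime_gt_0_nat)
  then obtain r where r: "p = Suc r" by (cases p) auto
  have inner: "[(p choose Suc k)] \<cdot> (x [^] Suc k \<otimes> y [^] (p - Suc k)) = \<zero>" if "k < r" for k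
    using that r by (intro add_pow_eq_zero_of_dvd[OF char] dvd_choose_prime p) auto
  have "(x \<oplus> y) [^] p
      = (\<Oplus>k\<in>{..r}. [(p choose Suc k)] \<cdot> (x [^] Suc k \<otimes> y [^] (p - Suc k))) \<oplus> y [^] p"
    unfolding binomial_theorem[OF assms(3,4), of p] unfolding r
    by (subst finsum_Suc2) (auto simp: Pi_def)
  also have "(\<Oplus>k\<in>{..r}. [(p choose Suc k)] \<cdot> (x [^] Suc k \<otimes> y [^] (p - Suc k)))
      = (\<Oplus>k\<in>{..r}. if r = k then x [^] p else \<zero>)"
    using inner by (intro finsum_cong') (auto simp: r Pi_def binomial_eq_0 simp del: binomial_Suc_Suc)
  also have "\<dots> = x [^] p"
    by (rule finsum_singleton) auto
  finally show ?thesis .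
qed

lemma (in cring) freshmans_dream_power:
  fixes p n :: nat
  assumes p: "Factorial_Ring.prime p" and char: "[p] \<cdot> \<one> = \<zero>"
    and [simp]: "x \<in> carrier R" "y \<in> carrier R"
  shows "(x \<oplus> y) [^] (p ^ n) = x [^] (p ^ n) \<oplus> y [^] (p ^ n)"
proof (induction n)
  case 0
  show ?case by simp
next
  case (Suc n)
  have "z [^] (p ^ Suc n) = (z [^] (p ^ n)) [^] p" if "z \<in> carrier R" for z
    using that by (simp add: nat_pow_pow mult.commute)
  then show ?case
    using Suc.IH freshmans_dream[OF p char] by simp
qed

text \<open>
  Closure under negation follows from additivity, which forces \<open>(-x)^(p^n) + x^(p^n) = 0\<close>; no
  distinction between \<open>p = 2\<close> and odd \<open>p\<close> is made.
\<close>
lemma (in cring) frobenius_fixed_subring: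
  fixes p n :: nat
  assumes p: "Factorial_Ring.prime p" and char: "[p] \<cdot> \<one> = \<zero>"
  shows "subring {x \<in> carrier R. x [^] (p ^ n) = x} R"
proof (rule subringI)
  fix x assume x: "x \<in> {x \<in> carrier R. x [^] (p ^ n) = x}"
  have "p ^ n \<noteq> 0" using p by (simp add: prime_gt_0_nat)
  then have "\<zero> = (\<ominus> x \<oplus> x) [^] (p ^ n)"
    using x by (simp add: l_neg nat_pow_zero)
  also have "\<dots> = (\<ominus> x) [^] (p ^ n) \<oplus> x"
    using x freshmans_dream_power[OF p char, of "\<ominus> x" x n] by simp
  finally have "(\<ominus> x) [^] (p ^ n) = \<ominus> x"
    using x by (intro minus_equality[symmetric]) auto
  then show "\<ominus> x \<in> {x \<in> carrier R. x [^] (p ^ n) = x}" using x by simp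
qed (auto simp: freshmans_dream_power[OF p char] nat_pow_distrib)

section \<open>Adjoining an element to the prime subring\<close>

lemma (in ring) prime_subring_least:
  assumes "subring S R"
  shows "prime_subring R \<subseteq> S"
  using add.subgroup_int_pow_closed[of S \<one>] subring.axioms(1)[OF assms] subringE(3)[OF assms]
  by (auto simp: prime_subring_def)

lemma (in ring) prime_adjoin_least:
  assumes "subring S R" "\<beta> \<in> S"
  shows "prime_adjoin R \<beta> \<subseteq> S"
  unfolding prime_adjoin_def
  using assms prime_subring_least by (intro generate_ring_min_subring1) (auto dest: subringE(1))

lemma (in ring) subring_prime_adjoin:
  assumes "\<beta> \<in> carrier R"
  shows "subring (prime_adjoin R \<beta>) R"
  unfolding prime_adjoin_def
  using assms prime_subring_least[OF carrier_is_subring] by (intro generate_ring_is_subring) auto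

lemma (in ring) generator_in_prime_adjoin: "\<beta> \<in> prime_adjoin R \<beta>"
  by (simp add: prime_adjoin_def generate_ring.incl)

lemma (in ring) subring_nat_pow_closed:
  fixes n :: nat
  assumes "subring A R" "x \<in> A"
  shows "x [^] n \<in> A"
  using assms by (induction n) (auto intro: subringE(3,6))

section \<open>Finite local rings\<close>

text \<open>
  A nonunit generates a proper ideal. As \<open>R\<close> has only finitely many ideals, some proper ideal
  above it is maximal, without any appeal to Zorn's lemma, and \<open>M\<close> is the only candidate.
\<close>
lemma (in local_cring) nonmember_is_unit:
  assumes fin: "finite (carrier R)" and x: "x \<in> carrier R" "x \<notin> M"
  shows "x \<in> Units R"
proof (rule ccontr)
  assume nonunit: "x \<notin> Units R"
  define P where "P = {J. ideal J R \<and> x \<in> J \<and> J \<noteq> carrier R}"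
  have "finite P"
    by (rule finite_subset[of _ "Pow (carrier R)"])
      (use fin in \<open>auto simp: P_def dest: additive_subgroup.a_subset[OF ideal.axioms(1)]\<close>)
  moreover have "PIdl x \<in> P"
  proof -
    have "\<one> \<notin> PIdl x"
    proof
      assume "\<one> \<in> PIdl x"
      then obtain r where "r \<in> carrier R" "\<one> = r \<otimes> x" by (auto simp: cgenideal_def)
      then show False using nonunit x m_comm by (force simp: Units_def)
    qed
    then show ?thesis
      using x cgenideal_ideal[of x] cgenideal_self[of x] one_closed by (auto simp: P_def)
  qed
  ultimately obtain J where J: "J \<in> P" "\<And>K. K \<in> P \<Longrightarrow> J \<subseteq> K \<Longrightarrow> K = J"
    using finite_has_maximal[of P] by (metis empty_iff)
  have "maximalideal J R"
    using J by (intro maximalidealI) (auto simp: P_def)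
  then have "J = M" by (rule maximal_unique)
  then show False using J(1) x(2) by (simp add: P_def)
qed

text \<open>
  With \<open>y = x^(q-1)\<close>, which lies in \<open>M\<close>, the hypothesis reads \<open>(1 - y) * x = 0\<close>, and \<open>1 - y\<close> is
  a unit because it is not in \<open>M\<close>.
\<close>
lemma (in local_cring) member_pow_eq_self_imp_zero:
  fixes q :: nat
  assumes fin: "finite (carrier R)" and x: "x \<in> M" and q: "1 < q" and eq: "x [^] q = x"
  shows "x = \<zero>"
proof -
  have xR [simp]: "x \<in> carrier R" using x a_subset by blast
  \<comment> \<open>\<open>q > 1\<close> makes \<open>y\<close> below a multiple of \<open>x\<close>; for \<open>q = 1\<close> it would be \<open>1\<close>.\<close>
  obtain r where r: "q = Suc (Suc r)" using q by (metis less_imp_Suc_add plus_1_eq_Suc add_Suc)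
  define y where "y = x [^] Suc r"
  have y: "y \<in> M" "y \<in> carrier R" using x by (auto simp: y_def I_l_closed)
  have "\<one> \<ominus> y \<notin> M"
  proof
    assume "\<one> \<ominus> y \<in> M"
    then have "(\<one> \<ominus> y) \<oplus> y \<in> M" using y a_closed by blast
    then have "\<one> \<in> M" using y by (simp add: minus_eq a_assoc l_neg)
    then show False using one_imp_carrier I_notcarr by blast
  qed
  then have unit: "\<one> \<ominus> y \<in> Units R"
    using y by (intro nonmember_is_unit[OF fin]) auto
  have "y \<otimes> x = x" using eq r by (simp add: y_def)
  then have "(\<one> \<ominus> y) \<otimes> x = \<zero>"
    using y by (simp add: minus_eq l_distr l_minus r_neg)
  then show "x = \<zero>"
    using unit y Units_l_cancel[of "\<one> \<ominus> y" x \<zero>] by simp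
qed

lemma (in local_cring) residue_map_hom: "ring_hom_ring R (R Quot M) (residue_map R M)"
  using rcos_ring_hom_ring unfolding residue_map_def[abs_def] .

lemma (in local_cring) residue_map_onto: "residue_map R M ` carrier R = carrier (R Quot M)"
  by (auto simp: residue_map_def FactRing_def A_RCOSETS_def')

lemma (in local_cring) residue_map_eq_zero_iff:
  assumes "x \<in> carrier R"
  shows "residue_map R M x = \<zero>\<^bsub>R Quot M\<^esub> \<longleftrightarrow> x \<in> M"
  using assms a_rcos_const a_rcos_self by (auto simp: residue_map_def FactRing_def)

text \<open>
  The residue map restricted to \<open>A\<close> has kernel \<open>A \<inter> M\<close>, so it is bijective onto the residue field,
  and its inverse transports the field structure back: \<open>A\<close> is the image of a field under a ring
  homomorphism to \<open>R\<close>.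
\<close>
lemma (in local_cring) coefficient_field_if_meets_ideal_trivially:
  assumes A: "subring A R" and inter: "\<And>x. x \<in> A \<Longrightarrow> x \<in> M \<Longrightarrow> x = \<zero>"
    and onto: "carrier (R Quot M) = residue_map R M ` A"
  shows "coefficient_field R M A"
proof -
  interpret Q: field "R Quot M" by (rule quotient_is_field) (rule is_cring)
  interpret h: ring_hom_ring R "R Quot M" "residue_map R M" by (rule residue_map_hom)
  have AR: "A \<subseteq> carrier R" by (rule subringE(1)[OF A])
  have inj: "inj_on (residue_map R M) A"
  proof (rule inj_onI)
    fix x y assume xy: "x \<in> A" "y \<in> A" "residue_map R M x = residue_map R M y"
    then have R: "x \<in> carrier R" "y \<in> carrier R" using AR by auto
    have "residue_map R M (x \<ominus> y) = \<zero>\<^bsub>R Quot M\<^esub>"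
      using R xy(3) by (simp add: minus_eq Q.r_neg)
    then have "x \<ominus> y \<in> M" using R residue_map_eq_zero_iff[of "x \<ominus> y"] by simp
    moreover have "x \<ominus> y \<in> A"
      unfolding minus_eq using xy(1,2) by (intro subringE(5,7)[OF A])
    ultimately have "x \<ominus> y = \<zero>" by (rule inter[rotated])
    then show "x = y" using R by simp
  qed
  have "residue_map R M \<in> ring_iso (R\<lparr>carrier := A\<rparr>) (R Quot M)"
    using ring_hom_ring.homh[OF h.induced_ring_hom[OF A]] inj onto
    by (simp add: ring_iso_def bij_betw_def)
  moreover have "subfield A R"
  proof -
    have "ring_hom_ring (R Quot M) R (inv_into A (residue_map R M))"
      using h.inv_ring_hom[OF inj A] onto[symmetric] by simp
    from ring_hom_ring.img_is_subfield(2)[OF this Q.carrier_is_subfield]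
    have "subfield (inv_into A (residue_map R M) ` carrier (R Quot M)) R"
      using Q.one_not_zero h.hom_one h.hom_zero by fastforce
    then show ?thesis using inj onto by simp
  qed
  ultimately show ?thesis by (simp add: coefficient_field_def)
qed

section \<open>Roots of unity lifting a generator of the residue field\<close>

text \<open>Lagrange's theorem in the multiplicative group; multiplying by \<open>a\<close> includes \<open>a = 0\<close>.\<close>

lemma (in field) pow_card_carrier:
  assumes fin: "finite (carrier R)" and a: "a \<in> carrier R"
  shows "a [^] card (carrier R) = a"
proof (cases "a = \<zero>")
  case True
  have "card (carrier R) \<noteq> 0" using fin by auto
  with True show ?thesis by (simp add: nat_pow_zero)
next
  case False
  interpret G: group "Multiplicative_Group.mult_of R" by (rule field_mult_group)
  have "card (carrier R) = Suc (order (Multiplicative_Group.mult_of R))"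
    using card.remove[OF fin zero_closed]
    by (simp add: order_def Multiplicative_Group.carrier_mult_of)
  then show ?thesis
    using False a G.pow_order_eq_1[of a] by (simp add: Multiplicative_Group.nat_pow_mult_of)
qed

lemma (in local_cring) residue_map_onto_if_lifts_generator:
  assumes gen: "carrier (R Quot M) - {\<zero>\<^bsub>R Quot M\<^esub>} = {residue_map R M \<beta> [^]\<^bsub>R Quot M\<^esub> i | i::nat. i \<in> UNIV}"
    and S: "subring S R" "\<beta> \<in> S"
  shows "carrier (R Quot M) = residue_map R M ` S"
proof -
  interpret h: ring_hom_ring R "R Quot M" "residue_map R M" by (rule residue_map_hom)
  have \<beta>R: "\<beta> \<in> carrier R" using S subringE(1) by blast
  show ?thesis
  proof
    show "residue_map R M ` S \<subseteq> carrier (R Quot M)"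
      using subringE(1)[OF S(1)] by auto
    show "carrier (R Quot M) \<subseteq> residue_map R M ` S"
    proof
      fix z assume z: "z \<in> carrier (R Quot M)"
      show "z \<in> residue_map R M ` S"
      proof (cases "z = \<zero>\<^bsub>R Quot M\<^esub>")
        case True
        then show ?thesis using subringE(2)[OF S(1)] h.hom_zero by (metis image_eqI)
      next
        case False
        then have "z \<in> carrier (R Quot M) - {\<zero>\<^bsub>R Quot M\<^esub>}" using z by simp
        then obtain i :: nat where "z = residue_map R M \<beta> [^]\<^bsub>R Quot M\<^esub> i"
          using gen by auto
        then have "z = residue_map R M (\<beta> [^] i)" using \<beta>R by (simp add: h.hom_nat_pow)
        then show ?thesis using subring_nat_pow_closed[OF S] by blast
      qed
    qed
  qed
qed

text \<open>
  An arbitrary lift \<open>b\<close> of a generator \<open>a\<close> need not be a root of unity of the required order, but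
  its sequence of \<open>p^m\<close>-th power iterates stays above \<open>a\<close> and is eventually periodic. Any member
  \<open>\<beta>\<close> of the periodic part works, with \<open>t\<close> a period.
\<close>
lemma (in local_cring) exists_root_of_unity_lifting_generator:
  fixes p m :: nat
  assumes fin: "finite (carrier R)" and card: "card (carrier (R Quot M)) = p ^ m"
  shows "\<exists>\<beta>\<in>carrier R. (\<exists>t::nat. 0 < t \<and> \<beta> [^] (p ^ (m * t) - 1) = \<one>)
    \<and> carrier (R Quot M) = residue_map R M ` prime_adjoin R \<beta>"
proof -
  interpret Q: field "R Quot M" by (rule quotient_is_field) (rule is_cring)
  interpret h: ring_hom_ring R "R Quot M" "residue_map R M" by (rule residue_map_hom)
  have finQ: "finite (carrier (R Quot M))"
    using fin residue_map_onto by (metis finite_imageI)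
  obtain a where a: "a \<in> carrier (R Quot M) - {\<zero>\<^bsub>R Quot M\<^esub>}"
    "carrier (R Quot M) - {\<zero>\<^bsub>R Quot M\<^esub>} = {a [^]\<^bsub>R Quot M\<^esub> i | i::nat. i \<in> UNIV}"
    using Q.finite_field_mult_group_has_gen[OF finQ] by auto
  have "a \<in> residue_map R M ` carrier R" using a(1) residue_map_onto by blast
  then obtain b where b: "b \<in> carrier R" "residue_map R M b = a" by blast
  have "a [^]\<^bsub>R Quot M\<^esub> ((p ^ m) ^ i) = a" for i
  proof (induction i)
    case (Suc i)
    have "a [^]\<^bsub>R Quot M\<^esub> ((p ^ m) ^ Suc i) = (a [^]\<^bsub>R Quot M\<^esub> ((p ^ m) ^ i)) [^]\<^bsub>R Quot M\<^esub> (p ^ m)"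
      using a(1) by (simp add: Q.nat_pow_pow mult.commute)
    also have "\<dots> = a"
      using Suc Q.pow_card_carrier[OF finQ] a(1) card by simp
    finally show ?case .
  qed (use a in simp)
  then have res: "residue_map R M (b [^] ((p ^ m) ^ i)) = a" for i
    using b by (simp add: h.hom_nat_pow)
  have "range (\<lambda>i::nat. b [^] ((p ^ m) ^ i)) \<subseteq> carrier R" using b by auto
  then have "\<not> inj (\<lambda>i::nat. b [^] ((p ^ m) ^ i))"
    using fin finite_subset range_inj_infinite by blast
  then obtain i j :: nat where "i < j" "b [^] ((p ^ m) ^ i) = b [^] ((p ^ m) ^ j)"
    unfolding inj_def by (metis linorder_neqE_nat)
  then obtain t :: nat where t: "0 < t" "b [^] ((p ^ m) ^ i) = b [^] ((p ^ m) ^ (i + t))"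
    by (metis less_imp_add_positive)
  define \<beta> where "\<beta> = b [^] ((p ^ m) ^ i)"
  have \<beta>R: "\<beta> \<in> carrier R" using b by (simp add: \<beta>_def)
  have \<beta>a: "residue_map R M \<beta> = a" by (simp add: \<beta>_def res)
  have "\<beta> \<notin> M"
    using a(1) \<beta>a \<beta>R by (auto simp: residue_map_eq_zero_iff[symmetric])
  then have unit: "\<beta> \<in> Units R" using nonmember_is_unit[OF fin \<beta>R] by blast
  have "p ^ m \<noteq> 0" using card finQ Q.zero_closed by (metis card_eq_0_iff empty_iff)
  then have q: "p ^ (m * t) = Suc (p ^ (m * t) - 1)" by (simp add: power_mult)
  \<comment> \<open>Periodicity says \<open>\<beta>^(p^(m*t)) = \<beta>\<close>; cancel the unit \<open>\<beta>\<close>.\<close>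
  have "\<beta> \<otimes> \<beta> [^] (p ^ (m * t) - 1) = \<beta> [^] Suc (p ^ (m * t) - 1)"
    using \<beta>R by (simp add: m_comm)
  also have "\<dots> = b [^] ((p ^ m) ^ (i + t))"
    unfolding q[symmetric] using b(1) by (simp add: \<beta>_def nat_pow_pow power_add power_mult)
  also have "\<dots> = \<beta> \<otimes> \<one>" using t(2) \<beta>R by (simp add: \<beta>_def)
  finally have "\<beta> [^] (p ^ (m * t) - 1) = \<one>"
    using Units_l_cancel[OF unit] \<beta>R by (metis nat_pow_closed one_closed)
  moreover have "carrier (R Quot M) = residue_map R M ` prime_adjoin R \<beta>"
    using a(2) \<beta>a by (intro residue_map_onto_if_lifts_generator[OF _ subring_prime_adjoin[OF \<beta>R] generator_in_prime_adjoin]) simp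
  ultimately show ?thesis using t(1) \<beta>R by blast
qed

section \<open>Coefficient fields\<close>

theorem theorem2p2:
  fixes R :: "('a, 'b) ring_scheme" (structure)
    and M :: "'a set" and p m :: nat
  assumes "Factorial_Ring.prime p"
    and "local_cring R M"
    and "finite (carrier R)"
    and "ring_char R = p"
    and "card (carrier (R Quot M)) = p ^ m"
  shows "(\<exists>\<beta> A. \<beta> \<in> carrier R \<and> subring A R \<and> A = prime_adjoin R \<beta>
            \<and> (\<exists>t::nat. 0 < t \<and> \<beta> [^] (p ^ (m * t) - 1) = \<one>)
            \<and> carrier (R Quot M) = residue_map R M ` A)
       \<and> (\<forall>\<beta> A. \<beta> \<in> carrier R \<and> subring A R \<and> A = prime_adjoin R \<beta>
            \<and> (\<exists>t::nat. 0 < t \<and> \<beta> [^] (p ^ (m * t) - 1) = \<one>)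
            \<and> carrier (R Quot M) = residue_map R M ` A
            \<longrightarrow> coefficient_field R M A)"
proof -
  interpret local_cring R M by fact
  interpret Q: field "R Quot M" by (rule quotient_is_field) (rule is_cring)
  have char: "[p] \<cdot> \<one> = \<zero>"
    using assms(1,4) by (intro ring_char_add_pow_one) (simp_all add: prime_gt_0_nat)
  \<comment> \<open>Needed for \<open>p^(m*t) > 1\<close>: a residue field has at least two elements.\<close>
  have "m \<noteq> 0"
  proof
    assume "m = 0"
    then have "card (carrier (R Quot M)) = 1" using assms(5) by simp
    then show False
      using Q.one_not_zero Q.one_closed Q.zero_closed by (metis card_1_singletonE singletonD)
  qed
  show ?thesis
  proof (intro conjI allI impI)
    show "\<exists>\<beta> A. \<beta> \<in> carrier R \<and> subring A R \<and> A = prime_adjoin R \<beta>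
            \<and> (\<exists>t::nat. 0 < t \<and> \<beta> [^] (p ^ (m * t) - 1) = \<one>)
            \<and> carrier (R Quot M) = residue_map R M ` A"
      using exists_root_of_unity_lifting_generator[OF assms(3,5)] subring_prime_adjoin by blast
  next
    fix \<beta> A
    assume *: "\<beta> \<in> carrier R \<and> subring A R \<and> A = prime_adjoin R \<beta>
            \<and> (\<exists>t::nat. 0 < t \<and> \<beta> [^] (p ^ (m * t) - 1) = \<one>)
            \<and> carrier (R Quot M) = residue_map R M ` A"
    then have \<beta>: "\<beta> \<in> carrier R" and A: "subring A R" "A = prime_adjoin R \<beta>"
      and onto: "carrier (R Quot M) = residue_map R M ` A" by blast+
    obtain t :: nat where t: "0 < t" "\<beta> [^] (p ^ (m * t) - 1) = \<one>" using * by blast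
    define q where "q = p ^ (m * t)"
    have q: "1 < q"
      unfolding q_def using \<open>m \<noteq> 0\<close> t(1) prime_gt_1_nat[OF assms(1)]
      by (intro one_less_power) auto
    have "\<beta> [^] q = \<beta> [^] Suc (q - 1)" using q by (metis Suc_diff_1 less_trans zero_less_one)
    also have "\<dots> = \<beta>" using t(2) \<beta> unfolding q_def nat_pow_Suc by simp
    finally have "\<beta> \<in> {x \<in> carrier R. x [^] (p ^ (m * t)) = x}" using \<beta> by (simp add: q_def)
    then have "A \<subseteq> {x \<in> carrier R. x [^] (p ^ (m * t)) = x}"
      unfolding A(2) by (intro prime_adjoin_least frobenius_fixed_subring[OF assms(1) char])
    then have "x = \<zero>" if "x \<in> A" "x \<in> M" for x
      using member_pow_eq_self_imp_zero[OF assms(3) that(2) q] that(1) by (auto simp: q_def)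
    then show "coefficient_field R M A"
      using coefficient_field_if_meets_ideal_trivially[OF A(1) _ onto] by blast
  qed
qed

end
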